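(* For every constant $p\ge 1$ there exist constants $a>0$ and $c>1$ (depending only on $p$) such that for every $n\ge 2$, every straight-line drawing $\Gamma$ of the star $K_{1,n-1}$ with ply-number $\mathsf{pn}(\Gamma)\le p$ has exponential area, i.e. the ratio between the length of its longest edge and the length of its shortest edge is at least $a\,c^{n}$.
   Context: $K_{1,n-1}$ is the $n$-vertex star (one central vertex adjacent to $n-1$ leaves). In a straight-line drawing $\Gamma$ of a graph $G$, the ply-disk $D_v$ of a vertex $v$ is the open disk centered at $v$ whose radius $r_v$ is half the length of the longest edge incident to $v$. For a point $q\in\mathbb{R}^2$ let $S_q=\{D_v : \|v-q\|<r_v\}$. The ply-number of $\Gamma$ is $\mathsf{pn}(\Gamma)=\max_{q\in\mathbb{R}^2}|S_q|$. Following the paper, a drawing is said to have exponential area when the ratio of its longest to its shortest edge length is exponential in the number of vertices. *)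

theory Defs
  imports "HOL-Analysis.Analysis"
begin

text \<open>
  A finite simple graph is given by its vertex set \<open>V\<close> and its set \<open>E\<close> of two-element
  subsets of \<open>V\<close>. A straight-line drawing is determined by the positions \<open>\<Gamma>\<close> of the vertices,
  which must be distinct points: the edge \<open>{u, v}\<close> is drawn as the segment from \<open>\<Gamma> u\<close> to
  \<open>\<Gamma> v\<close>, so that its length is \<open>dist (\<Gamma> u) (\<Gamma> v)\<close>. Edges may cross or overlap.
\<close>

definition straight_line_drawing :: "'v set \<Rightarrow> ('v \<Rightarrow> real^2) \<Rightarrow> bool" where
  "straight_line_drawing V \<Gamma> \<longleftrightarrow> inj_on \<Gamma> V"

text \<open>The radius is only meaningful for a vertex with at least one and finitely many neighbours.\<close>

definition ply_radius :: "'v set set \<Rightarrow> ('v \<Rightarrow> real^2) \<Rightarrow> 'v \<Rightarrow> real" where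
  "ply_radius E \<Gamma> v = Max {dist (\<Gamma> v) (\<Gamma> u) | u. {v, u} \<in> E} / 2"

definition ply_disk :: "'v set set \<Rightarrow> ('v \<Rightarrow> real^2) \<Rightarrow> 'v \<Rightarrow> (real^2) set" where
  "ply_disk E \<Gamma> v = ball (\<Gamma> v) (ply_radius E \<Gamma> v)"

definition ply_disks_at ::
    "'v set \<Rightarrow> 'v set set \<Rightarrow> ('v \<Rightarrow> real^2) \<Rightarrow> real^2 \<Rightarrow> (real^2) set set" where
  "ply_disks_at V E \<Gamma> q = {ply_disk E \<Gamma> v | v. v \<in> V \<and> norm (\<Gamma> v - q) < ply_radius E \<Gamma> v}"

text \<open>For finite \<open>V\<close> the maximum is over a finite set of numbers, each at most \<open>card V\<close>.\<close>

definition ply_number :: "'v set \<Rightarrow> 'v set set \<Rightarrow> ('v \<Rightarrow> real^2) \<Rightarrow> nat" where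
  "ply_number V E \<Gamma> = Max (range (\<lambda>q. card (ply_disks_at V E \<Gamma> q)))"

definition edge_lengths :: "'v set set \<Rightarrow> ('v \<Rightarrow> real^2) \<Rightarrow> real set" where
  "edge_lengths E \<Gamma> = {dist (\<Gamma> u) (\<Gamma> v) | u v. {u, v} \<in> E}"

definition edge_length_ratio :: "'v set set \<Rightarrow> ('v \<Rightarrow> real^2) \<Rightarrow> real" where
  "edge_length_ratio E \<Gamma> = Max (edge_lengths E \<Gamma>) / Min (edge_lengths E \<Gamma>)"

text \<open>The star \<open>K\<^bsub>1,n-1\<^esub>\<close> on \<open>n\<close> vertices has centre \<open>0\<close> and leaves \<open>1, \<dots>, n - 1\<close>.\<close>

definition star_verts :: "nat \<Rightarrow> nat set" where
  "star_verts n = {0..<n}"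

definition star_edges :: "nat \<Rightarrow> nat set set" where
  "star_edges n = {{0, i} | i. i \<in> {1..<n}}"

end

theory Submission
  imports Defs
begin

text \<open>
  A leaf at distance \<open>d\<close> from the centre of the star has a ply-disk of radius \<open>d / 2\<close>. If
  \<open>L \<le> d \<le> 2 L\<close>, the leaf lies in a disk of radius \<open>2 L\<close>, which is covered by a number \<open>N\<close> of
  disks of radius \<open>L / 2\<close> that does not depend on \<open>L\<close>, and the centre of a covering disk lies in
  the ply-disks of all leaves in that covering disk. So every such dyadic annulus contains at most
  \<open>N p\<close> leaves, and \<open>n - 1\<close> leaves need a number of annuli that is linear in \<open>n\<close>.
\<close>

text \<open>Positivity of \<open>r\<close> matters: all balls of nonpositive radius are empty and
  hence equal.\<close>

lemma ball_eq_imp_centre_eq: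
  fixes x y :: "'a::euclidean_space"
  assumes "ball x r = ball y s" and "r > 0"
  shows "x = y"
  using assms by (auto simp: ball_eq_ball_iff)

lemma cball_finite_net:
  fixes e :: real
  assumes "e > 0"
  obtains Q :: "'a::euclidean_space set"
    where "finite Q" and "cball 0 r \<subseteq> (\<Union>q\<in>Q. ball q e)"
proof -
  have "compact (cball (0::'a) r)" by simp
  then show thesis
    using assms that unfolding compact_eq_totally_bounded by blast
qed

text \<open>Sort the indices by the integer part of \<open>log 2 (d i / m)\<close>. Each class lies
  in one band \<open>[L, 2 * L]\<close> with \<open>L = m * 2 ^ j\<close>, and the values of
  \<open>j\<close> run from 0 to the integer part of \<open>log 2 (M / m)\<close>.\<close>

lemma card_le_of_dyadic_bands:
  fixes d :: "'a \<Rightarrow> real"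
  assumes fin: "finite I" and m: "m > 0" and R: "m \<le> M"
    and d: "\<And>i. i \<in> I \<Longrightarrow> m \<le> d i \<and> d i \<le> M"
    and band: "\<And>L. L > 0 \<Longrightarrow> real (card {i \<in> I. L \<le> d i \<and> d i \<le> 2 * L}) \<le> B"
  shows "real (card I) \<le> B * (log 2 (M / m) + 1)"
proof -
  define f where "f i = nat \<lfloor>log 2 (d i / m)\<rfloor>" for i
  define k where "k = nat \<lfloor>log 2 (M / m)\<rfloor>"
  \<comment> \<open>Any band would do: \<open>B\<close> bounds a cardinality. The sign is needed for
    the last estimate, which multiplies by \<open>B\<close>.\<close>
  have B: "0 \<le> B" using band[of 1] by (meson of_nat_0_le_iff order_trans zero_less_one)
  have log_M: "0 \<le> log 2 (M / m)" using m R by simp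
  have f_le: "f i \<le> k" if "i \<in> I" for i
    using d[OF that] m unfolding f_def k_def
    by (intro nat_mono floor_mono) (simp add: divide_right_mono)
  have fibre: "{i \<in> I. f i = j} \<subseteq> {i \<in> I. m * 2 ^ j \<le> d i \<and> d i \<le> 2 * (m * 2 ^ j)}" for j
  proof (safe)
    fix i assume i: "i \<in> I"
    \<comment> \<open>Since the logarithm is nonnegative, \<open>nat\<close> does not truncate its
      floor.\<close>
    have pos: "d i / m > 0" and "log 2 (d i / m) \<ge> 0"
      using d[OF i] m by simp_all
    then have j: "real (f i) \<le> log 2 (d i / m)" "log 2 (d i / m) < real (f i) + 1"
      unfolding f_def by linarith+
    from j(1) have "2 ^ f i \<le> d i / m"
      using pos by (simp add: le_log_iff powr_realpow)
    then show "m * 2 ^ f i \<le> d i" using m by (simp add: field_simps)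
    from j(2) have "d i / m < 2 powr (real (f i) + 1)"
      using pos by (simp add: log_less_iff)
    then have "d i / m < 2 * 2 ^ f i" by (simp add: powr_add powr_realpow)
    then show "d i \<le> 2 * (m * 2 ^ f i)" using m by (simp add: field_simps)
  qed
  have "I = (\<Union>j\<in>{..k}. {i \<in> I. f i = j})" using f_le by auto
  then have "card I = card (\<Union>j\<in>{..k}. {i \<in> I. f i = j})" by simp
  also have "\<dots> \<le> (\<Sum>j\<le>k. card {i \<in> I. f i = j})" by (rule card_UN_le) simp
  finally have "real (card I) \<le> (\<Sum>j\<le>k. real (card {i \<in> I. f i = j}))"
    by (simp flip: of_nat_sum)
  also have "\<dots> \<le> (\<Sum>j\<le>k. B)"
  proof (rule sum_mono)
    fix j
    have "card {i \<in> I. f i = j} \<le> card {i \<in> I. m * 2 ^ j \<le> d i \<and> d i \<le> 2 * (m * 2 ^ j)}"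
      using fin fibre by (intro card_mono) auto
    then show "real (card {i \<in> I. f i = j}) \<le> B"
      using band[of "m * 2 ^ j"] m by simp
  qed
  also have "\<dots> = B * (real k + 1)" by simp
  also have "\<dots> \<le> B * (log 2 (M / m) + 1)"
    using B log_M unfolding k_def by (intro mult_left_mono) linarith+
  finally show ?thesis .
qed

lemma ply_disks_at_image:
  "ply_disks_at V E \<Gamma> q = ply_disk E \<Gamma> ` {v \<in> V. norm (\<Gamma> v - q) < ply_radius E \<Gamma> v}"
  unfolding ply_disks_at_def by auto

text \<open>\<open>ply_disks_at\<close> is a set of disks, so counting vertices needs their disks to be distinct.\<close>

lemma card_ply_disks_at:
  assumes "straight_line_drawing V \<Gamma>"
  shows "card (ply_disks_at V E \<Gamma> q) = card {v \<in> V. norm (\<Gamma> v - q) < ply_radius E \<Gamma> v}"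
  unfolding ply_disks_at_image
proof (rule card_image, rule inj_onI)
  fix u v
  assume u: "u \<in> {v \<in> V. norm (\<Gamma> v - q) < ply_radius E \<Gamma> v}"
    and v: "v \<in> {v \<in> V. norm (\<Gamma> v - q) < ply_radius E \<Gamma> v}"
    and eq: "ply_disk E \<Gamma> u = ply_disk E \<Gamma> v"
  \<comment> \<open>A norm lies strictly below this radius, so the disk is not empty and determines
    its centre.\<close>
  have "ply_radius E \<Gamma> u > 0" using u by (smt (verit) mem_Collect_eq norm_ge_zero)
  with eq have "\<Gamma> u = \<Gamma> v" unfolding ply_disk_def by (rule ball_eq_imp_centre_eq)
  with assms u v show "u = v" unfolding straight_line_drawing_def by (auto dest: inj_onD)
qed

lemma card_le_ply_number:
  assumes "finite V" and "straight_line_drawing V \<Gamma>"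
  shows "card {v \<in> V. norm (\<Gamma> v - q) < ply_radius E \<Gamma> v} \<le> ply_number V E \<Gamma>"
proof -
  \<comment> \<open>\<open>Max\<close> is an upper bound only for a finite set; \<open>q\<close>
    ranges over the whole plane, but the counts take finitely many values.\<close>
  have "range (\<lambda>q. card (ply_disks_at V E \<Gamma> q)) \<subseteq> {..card V}"
    using assms by (auto simp: card_ply_disks_at intro!: card_mono)
  then have "finite (range (\<lambda>q. card (ply_disks_at V E \<Gamma> q)))"
    using finite_subset by blast
  then have "card (ply_disks_at V E \<Gamma> q) \<le> ply_number V E \<Gamma>"
    unfolding ply_number_def by (intro Max_ge) auto
  then show ?thesis by (simp add: card_ply_disks_at[OF assms(2)])
qed

lemma star_edge_iff:
  "{u, v} \<in> star_edges n \<longleftrightarrow> (u = 0 \<and> v \<in> {1..<n}) \<or> (v = 0 \<and> u \<in> {1..<n})"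
  unfolding star_edges_def by (auto simp: doubleton_eq_iff)

text \<open>The centre is the only neighbour of a leaf, so the maximum is over a single
  length.\<close>

lemma ply_radius_leaf:
  assumes "i \<in> {1..<n}"
  shows "ply_radius (star_edges n) \<Gamma> i = dist (\<Gamma> 0) (\<Gamma> i) / 2"
proof -
  have "{dist (\<Gamma> i) (\<Gamma> u) | u. {i, u} \<in> star_edges n} = {dist (\<Gamma> 0) (\<Gamma> i)}"
    using assms by (auto simp: star_edge_iff dist_commute)
  then show ?thesis unfolding ply_radius_def by simp
qed

lemma edge_lengths_star:
  "edge_lengths (star_edges n) \<Gamma> = (\<lambda>i. dist (\<Gamma> 0) (\<Gamma> i)) ` {1..<n}"
  unfolding edge_lengths_def by (force simp: star_edge_iff dist_commute)

text \<open>The net \<open>Q\<close> is fixed at unit scale and carried to the annulus by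
  \<open>q \<mapsto> \<Gamma> 0 + L *\<^sub>R q\<close>, so the factor \<open>card Q\<close> is
  independent of \<open>L\<close>, \<open>n\<close> and the drawing.\<close>

lemma card_leaves_in_annulus:
  fixes \<Gamma> :: "nat \<Rightarrow> real^2" and Q :: "(real^2) set"
  assumes fin: "finite Q" and net: "cball 0 2 \<subseteq> (\<Union>q\<in>Q. ball q (1/2))"
    and draw: "straight_line_drawing (star_verts n) \<Gamma>" and L: "L > 0"
  shows "card {i \<in> {1..<n}. L \<le> dist (\<Gamma> 0) (\<Gamma> i) \<and> dist (\<Gamma> 0) (\<Gamma> i) \<le> 2 * L}
    \<le> card Q * ply_number (star_verts n) (star_edges n) \<Gamma>"
    (is "card ?A \<le> _ * ?P")
proof -
  define S where "S q = {v \<in> star_verts n. norm (\<Gamma> v - q) < ply_radius (star_edges n) \<Gamma> v}" for q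
  have finV: "finite (star_verts n)" by (simp add: star_verts_def)
  have "?A \<subseteq> (\<Union>q\<in>Q. S (\<Gamma> 0 + L *\<^sub>R q))"
  proof
    fix i assume "i \<in> ?A"
    then have i: "i \<in> {1..<n}" and lo: "L \<le> dist (\<Gamma> 0) (\<Gamma> i)"
      and hi: "dist (\<Gamma> 0) (\<Gamma> i) \<le> 2 * L" by auto
    define x where "x = (1 / L) *\<^sub>R (\<Gamma> i - \<Gamma> 0)"
    have x: "\<Gamma> i - \<Gamma> 0 = L *\<^sub>R x" using L by (simp add: x_def)
    have "norm x \<le> 2"
      using hi L by (simp add: x_def dist_norm norm_minus_commute divide_simps)
    then have "x \<in> cball 0 2" by simp
    with net obtain q where q: "q \<in> Q" and "x \<in> ball q (1/2)" by blast
    then have "norm (x - q) < 1 / 2" by (simp add: dist_norm norm_minus_commute)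
    have "\<Gamma> i - (\<Gamma> 0 + L *\<^sub>R q) = L *\<^sub>R (x - q)"
      using x by (simp add: algebra_simps)
    then have "norm (\<Gamma> i - (\<Gamma> 0 + L *\<^sub>R q)) = L * norm (x - q)" using L by simp
    also have "\<dots> < L / 2" using L \<open>norm (x - q) < 1 / 2\<close> by simp
    \<comment> \<open>The inner radius of the annulus enters here: it makes the ply-disk large
      enough to contain the net point.\<close>
    also have "\<dots> \<le> ply_radius (star_edges n) \<Gamma> i" using lo by (simp add: ply_radius_leaf[OF i])
    finally show "i \<in> (\<Union>q\<in>Q. S (\<Gamma> 0 + L *\<^sub>R q))"
      using i q by (auto simp: S_def star_verts_def)
  qed
  then have "card ?A \<le> card (\<Union>q\<in>Q. S (\<Gamma> 0 + L *\<^sub>R q))"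
    using fin finV by (intro card_mono) (auto simp: S_def)
  also have "\<dots> \<le> (\<Sum>q\<in>Q. card (S (\<Gamma> 0 + L *\<^sub>R q)))" by (rule card_UN_le[OF fin])
  also have "\<dots> \<le> (\<Sum>q\<in>Q. ?P)"
    unfolding S_def by (intro sum_mono card_le_ply_number finV draw)
  finally show ?thesis by simp
qed

theorem theorem1:
  fixes p :: real
  assumes "p \<ge> 1"
  shows "\<exists>a c :: real. a > 0 \<and> c > 1 \<and>
    (\<forall>n \<ge> 2. \<forall>\<Gamma> :: nat \<Rightarrow> real^2.
       straight_line_drawing (star_verts n) \<Gamma> \<longrightarrow>
       real (ply_number (star_verts n) (star_edges n) \<Gamma>) \<le> p \<longrightarrow>
       edge_length_ratio (star_edges n) \<Gamma> \<ge> a * c ^ n)"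
proof -
  obtain Q :: "(real^2) set" where fin: "finite Q" and net: "cball 0 2 \<subseteq> (\<Union>q\<in>Q. ball q (1/2))"
    using cball_finite_net[of "1/2" 2] by auto
  \<comment> \<open>A nonempty net makes \<open>B\<close> positive, so that division by
    \<open>B\<close> is legitimate.\<close>
  have "Q \<noteq> {}" using net by force
  define B where "B = real (card Q) * p"
  have B: "B > 0" using fin \<open>Q \<noteq> {}\<close> assms by (simp add: B_def card_gt_0_iff)
  \<comment> \<open>Solving \<open>n - 1 \<le> B * (log 2 (M / m) + 1)\<close> for the logarithm and
    exponentiating gives these constants; \<open>Q\<close>, and hence \<open>B\<close>, is chosen
    before \<open>n\<close> and the drawing.\<close>
  define a c :: real where "a = 2 powr (- 1 / B - 1)" and "c = 2 powr (1 / B)"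
  have "edge_length_ratio (star_edges n) \<Gamma> \<ge> a * c ^ n"
    if n: "n \<ge> 2" and draw: "straight_line_drawing (star_verts n) \<Gamma>"
      and ply: "real (ply_number (star_verts n) (star_edges n) \<Gamma>) \<le> p"
    for n and \<Gamma> :: "nat \<Rightarrow> real^2"
  proof -
    define m M where "m = Min (edge_lengths (star_edges n) \<Gamma>)"
      and "M = Max (edge_lengths (star_edges n) \<Gamma>)"
    have E: "finite (edge_lengths (star_edges n) \<Gamma>)" "edge_lengths (star_edges n) \<Gamma> \<noteq> {}"
      using n by (auto simp: edge_lengths_star)
    \<comment> \<open>Distinct positions make the shortest edge length, the denominator of the
      ratio, positive.\<close>
    have "\<Gamma> 0 \<noteq> \<Gamma> i" if "i \<in> {1..<n}" for i
      using draw that n unfolding straight_line_drawing_def star_verts_def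
      by (auto dest: inj_onD[of _ _ 0 i])
    then have m: "m > 0"
      unfolding m_def using E by (auto simp: edge_lengths_star)
    have bounds: "m \<le> dist (\<Gamma> 0) (\<Gamma> i) \<and> dist (\<Gamma> 0) (\<Gamma> i) \<le> M" if "i \<in> {1..<n}" for i
      unfolding m_def M_def using E that by (auto simp: edge_lengths_star)
    \<comment> \<open>Leaf 1 exists because \<open>n \<ge> 2\<close>.\<close>
    have mM: "m \<le> M" using bounds[of 1] n by auto
    have "real (card {1..<n}) \<le> B * (log 2 (M / m) + 1)"
    proof (rule card_le_of_dyadic_bands[OF _ m mM bounds])
      fix L :: real assume "L > 0"
      from card_leaves_in_annulus[OF fin net draw this]
      have "real (card {i \<in> {1..<n}. L \<le> dist (\<Gamma> 0) (\<Gamma> i) \<and> dist (\<Gamma> 0) (\<Gamma> i) \<le> 2 * L})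
        \<le> real (card Q) * real (ply_number (star_verts n) (star_edges n) \<Gamma>)"
        by (simp flip: of_nat_mult)
      also have "\<dots> \<le> B" unfolding B_def using ply by (intro mult_left_mono) auto
      finally show "real (card {i \<in> {1..<n}. L \<le> dist (\<Gamma> 0) (\<Gamma> i) \<and> dist (\<Gamma> 0) (\<Gamma> i) \<le> 2 * L}) \<le> B" .
    qed auto
    then have "real n - 1 \<le> B * (log 2 (M / m) + 1)" using n by (simp add: of_nat_diff)
    then have "- 1 / B - 1 + real n * (1 / B) \<le> log 2 (M / m)"
      using B by (simp add: field_simps)
    then have "2 powr (- 1 / B - 1 + real n * (1 / B)) \<le> M / m"
      using m mM by (simp add: le_log_iff)
    moreover have "a * c ^ n = 2 powr (- 1 / B - 1 + real n * (1 / B))"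
      unfolding a_def c_def powr_add by (simp add: powr_power mult.commute)
    ultimately show ?thesis unfolding edge_length_ratio_def m_def M_def by simp
  qed
  moreover have "a > 0" "c > 1" using B by (simp_all add: a_def c_def)
  ultimately show ?thesis by blast
qed

end
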